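(* Let $X$ be a Hausdorff space, $D\subset X$ an open set with $\partial D\ne\emptyset$, and $\omega_\cdot^D$ a harmonic measure relative to $D$. Suppose $D$ is regular (relative to $\omega_\cdot^D$) and $A\subseteq\partial D$ is open in $\partial D$. Then $$\sup_{x\in D}\omega_x^D(\chi_A)=\max_{y\in\partial D}\chi_A(y),$$ and if there exists an $x_0\in D$ such that $\omega^D_{x_0}(\chi_A)=\sup_{x\in D}\omega_x^D(\chi_A)$, then $\omega^D_x(\chi_A)$ is constant for $x\in D$.
   Context: Measures: a measure on a set $Y$ is a map $\omega:2^Y\to[0,\infty]$ with $\omega(\emptyset)=0$ and $\omega(A)\le\sum_k\omega(A_k)$ whenever $A\subseteq\bigcup_{k=1}^\infty A_k$ (an outer measure); measurability is in the sense of Carathéodory; it is Borel if every Borel set is measurable. $\nu\ll\mu$ means $\mu(A)=0\Rightarrow\nu(A)=0$ for every $A\subseteq Y$. Write $\omega(f)=\int f\,\mathrm d\omega$. Pre-harmonic measure: a family of Borel measures $\{\omega^D_x:2^{\partial D}\to[0,1]:x\in D\}$ on $\partial D$ such that for every connected component $V$ of $D$: (1) $\omega_x^D(\partial V)=1$ for all $x\in V$; (2) $\omega^D_x\ll\omega^D_y$ for all $x,y\in V$. Harmonic measure: let $\mathcal F_x=\{E\Delta N: E\subseteq\partial D\text{ Borel},\ N\subseteq\partial D,\ \omega_x^D(N)=0\}$ and $\mathcal F=\bigcap_{x\in D}\mathcal F_x$. Extended real-valued functions measurable w.r.t. $\mathcal F$ are called $\omega_\cdot^D$-measurable. The pre-harmonic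 measure restricted to $\mathcal F$ is the harmonic measure $\omega_\cdot^D$ relative to $D$. $L(\partial D;\omega_\cdot^D)$ is the set of $\omega_\cdot^D$-measurable $f$ on $\partial D$ integrable with respect to $\omega_x^D$ for every $x\in D$. A point $y\in\partial D$ is regular if for every $f\in L(\partial D;\omega_\cdot^D)$ continuous at $y$ and every sequence $x_n\to y$ in $D$, $\lim_n\omega_{x_n}^D(f)=f(y)$; $D$ is regular if every $y\in\partial D$ is regular. $\chi_A$ is the characteristic function of $A$.
   Formalization: Added hypothesis: every point of ∂D is the limit of a sequence in D (automatic if X is first countable; without it sup = max can fail). Constancy of ω_x(χ_A) is claimed only on each connected component of D containing such an x_0, since it fails on all of D when D is disconnected. *)

theory Defs
  imports "HOL-Analysis.Analysis"
begin

(* Measures in the sense of Caratheodory: outer measures on all subsets of Y.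
   Values on sets not contained in Y are irrelevant. *)

definition outer_measure_on :: "'a set \<Rightarrow> ('a set \<Rightarrow> ennreal) \<Rightarrow> bool" where
  "outer_measure_on Y w \<longleftrightarrow>
     w {} = 0 \<and>
     (\<forall>A B. A \<subseteq> Y \<longrightarrow> (\<forall>k::nat. B k \<subseteq> Y) \<longrightarrow> A \<subseteq> (\<Union>k. B k) \<longrightarrow> w A \<le> (\<Sum>k. w (B k)))"

abbreviation borel_sets_on :: "'a::topological_space set \<Rightarrow> 'a set set" where
  "borel_sets_on Y \<equiv> sets (restrict_space borel Y)"

definition borel_outer_measure_on :: "'a::topological_space set \<Rightarrow> ('a set \<Rightarrow> ennreal) \<Rightarrow> bool" where
  "borel_outer_measure_on Y w \<longleftrightarrow>
     outer_measure_on Y w \<and> borel_sets_on Y \<subseteq> lambda_system Y (Pow Y) w"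

definition outer_abs_continuous_on :: "'a set \<Rightarrow> ('a set \<Rightarrow> ennreal) \<Rightarrow> ('a set \<Rightarrow> ennreal) \<Rightarrow> bool" where
  "outer_abs_continuous_on Y v w \<longleftrightarrow> (\<forall>A\<subseteq>Y. w A = 0 \<longrightarrow> v A = 0)"

(* The boundary of a component V of D lies in the boundary of D whenever the ambient space is
   locally connected, but not in general; the measures live on the boundary of D, so the mass of
   the boundary of V is that of its part inside the boundary of D. *)

definition pre_harmonic_measure :: "'a::topological_space set \<Rightarrow> ('a \<Rightarrow> 'a set \<Rightarrow> ennreal) \<Rightarrow> bool" where
  "pre_harmonic_measure D \<omega> \<longleftrightarrow>
     (\<forall>x\<in>D. borel_outer_measure_on (frontier D) (\<omega> x) \<and> (\<forall>A\<subseteq>frontier D. \<omega> x A \<le> 1)) \<and>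
     (\<forall>V\<in>components D.
        (\<forall>x\<in>V. \<omega> x (frontier V \<inter> frontier D) = 1) \<and>
        (\<forall>x\<in>V. \<forall>y\<in>V. outer_abs_continuous_on (frontier D) (\<omega> x) (\<omega> y)))"

definition harmonic_sets_at :: "'a::topological_space set \<Rightarrow> ('a set \<Rightarrow> ennreal) \<Rightarrow> 'a set set" where
  "harmonic_sets_at D w =
     {sym_diff E N | E N. E \<in> borel_sets_on (frontier D) \<and> N \<subseteq> frontier D \<and> w N = 0}"

definition harmonic_sets :: "'a::topological_space set \<Rightarrow> ('a \<Rightarrow> 'a set \<Rightarrow> ennreal) \<Rightarrow> 'a set set" where
  "harmonic_sets D \<omega> = (\<Inter>x\<in>D. harmonic_sets_at D (\<omega> x))"

(* For a pre-harmonic measure, harmonic_sets D \<omega> is a sigma-algebra on the boundary of D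
   on which each \<omega> x is countably additive, so measure_of yields exactly the restriction. *)

definition harmonic_measure :: "'a::topological_space set \<Rightarrow> ('a \<Rightarrow> 'a set \<Rightarrow> ennreal) \<Rightarrow> 'a \<Rightarrow> 'a measure" where
  "harmonic_measure D \<omega> x = measure_of (frontier D) (harmonic_sets D \<omega>) (\<omega> x)"

(* Integration of extended-real-valued functions; e2ennreal sends negative values to 0, so the two
   nonnegative integrals below are those of the positive and negative part. *)

definition ereal_integrable :: "'a measure \<Rightarrow> ('a \<Rightarrow> ereal) \<Rightarrow> bool" where
  "ereal_integrable M f \<longleftrightarrow>
     f \<in> borel_measurable M \<and>
     (\<integral>\<^sup>+ y. e2ennreal (f y) \<partial>M) < \<infinity> \<and> (\<integral>\<^sup>+ y. e2ennreal (- f y) \<partial>M) < \<infinity>"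

definition ereal_integral :: "'a measure \<Rightarrow> ('a \<Rightarrow> ereal) \<Rightarrow> ereal" where
  "ereal_integral M f =
     enn2ereal (\<integral>\<^sup>+ y. e2ennreal (f y) \<partial>M) - enn2ereal (\<integral>\<^sup>+ y. e2ennreal (- f y) \<partial>M)"

definition harmonic_L :: "'a::t2_space set \<Rightarrow> ('a \<Rightarrow> 'a set \<Rightarrow> ennreal) \<Rightarrow> ('a \<Rightarrow> ereal) set" where
  "harmonic_L D \<omega> = {f. \<forall>x\<in>D. ereal_integrable (harmonic_measure D \<omega> x) f}"

definition regular_point :: "'a::t2_space set \<Rightarrow> ('a \<Rightarrow> 'a set \<Rightarrow> ennreal) \<Rightarrow> 'a \<Rightarrow> bool" where
  "regular_point D \<omega> y \<longleftrightarrow>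
     (\<forall>f\<in>harmonic_L D \<omega>. continuous (at y within frontier D) f \<longrightarrow>
        (\<forall>s. (\<forall>n::nat. s n \<in> D) \<longrightarrow> s \<longlonglongrightarrow> y \<longrightarrow>
           (\<lambda>n. ereal_integral (harmonic_measure D \<omega> (s n)) f) \<longlonglongrightarrow> f y))"

definition regular_set :: "'a::t2_space set \<Rightarrow> ('a \<Rightarrow> 'a set \<Rightarrow> ennreal) \<Rightarrow> bool" where
  "regular_set D \<omega> \<longleftrightarrow> (\<forall>y\<in>frontier D. regular_point D \<omega> y)"

(* Automatic if the ambient space is first countable. Regularity only tests sequences,
   hence says nothing at a boundary point that is not the limit of a sequence in D. *)

definition seq_accessible_boundary :: "'a::topological_space set \<Rightarrow> bool" where
  "seq_accessible_boundary D \<longleftrightarrow> (\<forall>y\<in>frontier D. \<exists>s. (\<forall>n::nat. s n \<in> D) \<and> s \<longlonglongrightarrow> y)"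

end

theory Submission
  imports Defs
begin

text \<open>The integral of \<^term>\<open>indicator A\<close> against the harmonic measure at \<^term>\<open>x\<close> is
  \<^term>\<open>\<omega> x A\<close>, which is at most 1. Regularity at a point of \<^term>\<open>A\<close>, where the
  indicator is continuous because \<^term>\<open>A\<close> is relatively open, gives the supremum 1 unless
  \<^term>\<open>A\<close> is empty. If the supremum 1 is attained at \<^term>\<open>x0\<close>, the complement of
  \<^term>\<open>A\<close> is null for \<^term>\<open>\<omega> x0\<close>, hence by mutual absolute continuity null for every
  point of the same component.\<close>

section \<open>Outer measures and Caratheodory measurability\<close>

lemma outer_measure_on_empty: "outer_measure_on Y w \<Longrightarrow> w {} = 0"
  by (simp add: outer_measure_on_def)

lemma outer_measure_on_countably_subadditive:
  fixes B :: "nat \<Rightarrow> 'a set"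
  assumes "outer_measure_on Y w" "A \<subseteq> (\<Union>k. B k)" "A \<subseteq> Y" "\<And>k. B k \<subseteq> Y"
  shows "w A \<le> (\<Sum>k. w (B k))"
  using assms by (simp add: outer_measure_on_def)

lemma outer_measure_on_mono:
  assumes "outer_measure_on Y w" "A \<subseteq> B" "B \<subseteq> Y"
  shows "w A \<le> w B"
proof -
  let ?B = "\<lambda>k::nat. if k = 0 then B else {}"
  have "w A \<le> (\<Sum>k. w (?B k))"
    by (rule outer_measure_on_countably_subadditive[OF assms(1)]) (use assms(2,3) in auto)
  also have "\<dots> = (\<Sum>k\<in>{0}. w (?B k))"
    by (rule suminf_finite) (simp_all add: outer_measure_on_empty[OF assms(1)])
  finally show ?thesis by simp
qed

lemma outer_measure_on_Un_le:
  assumes "outer_measure_on Y w" "A \<subseteq> Y" "B \<subseteq> Y"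
  shows "w (A \<union> B) \<le> w A + w B"
proof -
  have "range (binaryset A B) \<subseteq> Pow Y"
    using assms(2,3) by (auto simp: range_binaryset_eq)
  then have "w (A \<union> B) \<le> (\<Sum>k. w (binaryset A B k))"
    using assms by (intro outer_measure_on_countably_subadditive[OF assms(1)])
      (auto simp: UN_binaryset_eq)
  also have "\<dots> = w A + w B"
    by (rule suminf_binaryset_eq) (rule outer_measure_on_empty[OF assms(1)])
  finally show ?thesis .
qed

text \<open>The single covering condition splits into the monotonicity and countable subadditivity
  that Caratheodory's construction expects.\<close>

lemma outer_measure_on_imp_outer_measure_space:
  assumes "outer_measure_on Y w"
  shows "outer_measure_space (Pow Y) w"
  unfolding outer_measure_space_def
proof (intro conjI)
  show "positive (Pow Y) w"
    using assms by (auto simp: positive_def outer_measure_on_empty)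
  show "increasing (Pow Y) w"
    using outer_measure_on_mono[OF assms] by (auto simp: increasing_def)
  show "countably_subadditive (Pow Y) w"
    unfolding countably_subadditive_def
  proof (intro allI impI)
    fix B :: "nat \<Rightarrow> 'a set"
    assume "range B \<subseteq> Pow Y" and U: "(\<Union>i. B i) \<in> Pow Y"
    then have "\<forall>k. B k \<subseteq> Y" by auto
    with U show "w (\<Union>i. B i) \<le> (\<Sum>i. w (B i))"
      by (intro outer_measure_on_countably_subadditive[OF assms]) auto
  qed
qed

lemma measure_space_lambda_system:
  assumes "outer_measure_on Y w"
  shows "measure_space Y (lambda_system Y (Pow Y) w) w"
  using sigma_algebra.caratheodory_lemma[OF sigma_algebra_Pow
      outer_measure_on_imp_outer_measure_space[OF assms]] .

text \<open>The part of a test set inside \<open>N\<close> has measure 0, so monotonicity and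
  subadditivity give the two inequalities of the splitting. This handles the null sets by which
  members of \<open>harmonic_sets_at\<close> differ from Borel sets.\<close>

lemma null_set_in_lambda_system:
  assumes w: "outer_measure_on Y w" and N: "N \<subseteq> Y" "w N = 0"
  shows "N \<in> lambda_system Y (Pow Y) w"
  unfolding lambda_system_def
proof (intro CollectI conjI ballI)
  show "N \<in> Pow Y" using N by auto
  fix x assume "x \<in> Pow Y"
  then have x: "x \<subseteq> Y" by auto
  have 0: "w (N \<inter> x) = 0"
    using outer_measure_on_mono[OF w, of "N \<inter> x" N] N by auto
  have "w ((Y - N) \<inter> x) \<le> w x"
    using outer_measure_on_mono[OF w _ x] by auto
  moreover have "w x \<le> w (N \<inter> x) + w ((Y - N) \<inter> x)"
  proof -
    have "x = (N \<inter> x) \<union> ((Y - N) \<inter> x)" using x by auto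
    then show ?thesis
      using outer_measure_on_Un_le[OF w, of "N \<inter> x" "(Y - N) \<inter> x"] x by auto
  qed
  ultimately show "w (N \<inter> x) + w ((Y - N) \<inter> x) = w x"
    using 0 by auto
qed

section \<open>The harmonic measure as a countably additive measure\<close>

lemma harmonic_sets_at_subset_lambda_system:
  assumes "borel_outer_measure_on (frontier D) w"
  shows "harmonic_sets_at D w \<subseteq> lambda_system (frontier D) (Pow (frontier D)) w"
proof
  let ?L = "lambda_system (frontier D) (Pow (frontier D)) w"
  have w: "outer_measure_on (frontier D) w"
    and L: "borel_sets_on (frontier D) \<subseteq> ?L"
    using assms by (auto simp: borel_outer_measure_on_def)
  interpret L: sigma_algebra "frontier D" ?L
    using measure_space_lambda_system[OF w] by (simp add: measure_space_def)
  fix A assume "A \<in> harmonic_sets_at D w"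
  then obtain E N where "A = sym_diff E N" "E \<in> borel_sets_on (frontier D)"
      "N \<subseteq> frontier D" "w N = 0"
    unfolding harmonic_sets_at_def by auto
  moreover from this have "E \<in> ?L" "N \<in> ?L"
    using L null_set_in_lambda_system[OF w] by auto
  ultimately show "A \<in> ?L" by auto
qed

text \<open>Take \<open>N = {}\<close> in the symmetric difference, at every \<open>x\<close> at
  once.\<close>

lemma borel_sets_on_subset_harmonic_sets:
  assumes "\<And>x. x \<in> D \<Longrightarrow> \<omega> x {} = 0"
  shows "borel_sets_on (frontier D) \<subseteq> harmonic_sets D \<omega>"
  using assms unfolding harmonic_sets_def harmonic_sets_at_def by blast

text \<open>\<open>measure_of\<close> passes to the generated sigma-algebra and yields the zero
  measure unless the set function is countably additive there. That sigma-algebra lies inside the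
  Caratheodory sigma-algebra of \<open>\<omega> x\<close>, from which additivity is
  inherited.\<close>

lemma
  assumes "pre_harmonic_measure D \<omega>" "x \<in> D"
  shows space_harmonic_measure: "space (harmonic_measure D \<omega> x) = frontier D"
    and borel_sets_on_subset_sets_harmonic_measure:
      "borel_sets_on (frontier D) \<subseteq> sets (harmonic_measure D \<omega> x)"
    and emeasure_harmonic_measure:
      "A \<in> borel_sets_on (frontier D) \<Longrightarrow> emeasure (harmonic_measure D \<omega> x) A = \<omega> x A"
proof -
  let ?M = "harmonic_measure D \<omega> x"
  let ?L = "lambda_system (frontier D) (Pow (frontier D)) (\<omega> x)"
  have b: "borel_outer_measure_on (frontier D) (\<omega> x)" if "x \<in> D" for x
    using assms that by (auto simp: pre_harmonic_measure_def)
  have w: "outer_measure_on (frontier D) (\<omega> x)"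
    using b assms by (auto simp: borel_outer_measure_on_def)
  have L: "measure_space (frontier D) ?L (\<omega> x)"
    by (rule measure_space_lambda_system[OF w])
  interpret L: sigma_algebra "frontier D" ?L
    using L by (simp add: measure_space_def)
  have HL: "harmonic_sets D \<omega> \<subseteq> ?L"
    using harmonic_sets_at_subset_lambda_system[OF b[OF assms(2)]] assms(2)
    unfolding harmonic_sets_def by blast
  then have H: "harmonic_sets D \<omega> \<subseteq> Pow (frontier D)"
    using L.space_closed by blast
  show sp: "space ?M = frontier D"
    using H by (simp add: harmonic_measure_def space_measure_of)
  have se: "sets ?M = sigma_sets (frontier D) (harmonic_sets D \<omega>)"
    using H by (simp add: harmonic_measure_def sets_measure_of)
  have SL: "sets ?M \<subseteq> ?L"
    unfolding se using HL by (rule L.sigma_sets_subset)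
  have "borel_sets_on (frontier D) \<subseteq> harmonic_sets D \<omega>"
    by (rule borel_sets_on_subset_harmonic_sets)
      (use b in \<open>auto simp: borel_outer_measure_on_def intro: outer_measure_on_empty\<close>)
  then show BS: "borel_sets_on (frontier D) \<subseteq> sets ?M"
    unfolding se by (auto intro: sigma_sets.Basic)
  assume "A \<in> borel_sets_on (frontier D)"
  with BS have A: "A \<in> sets ?M" by auto
  show "emeasure ?M A = \<omega> x A"
  proof (rule emeasure_measure_of[OF harmonic_measure_def H _ _ A])
    show "positive (sets ?M) (\<omega> x)"
      using w by (auto simp: positive_def outer_measure_on_empty)
    show "countably_additive (sets ?M) (\<omega> x)"
      using L SL unfolding measure_space_def countably_additive_def
      by (meson subset_iff)
  qed
qed

section \<open>Integrability and continuity of indicators\<close>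

lemma e2ennreal_indicator: "e2ennreal (indicator A y) = indicator A y"
  by (metis e2ennreal_enn2ereal indicator_eq_0_iff indicator_eq_1_iff one_ennreal.rep_eq
      zero_ennreal.rep_eq)

text \<open>Truncation at 0 makes the negative-part term of \<open>ereal_integral\<close> vanish for
  indicators.\<close>

lemma e2ennreal_uminus_indicator: "e2ennreal (- indicator A y) = 0"
  by (simp add: indicator_def e2ennreal_neg)

lemma ereal_integral_indicator:
  assumes "A \<in> sets M"
  shows "ereal_integral M (indicator A) = enn2ereal (emeasure M A)"
  using assms
  by (simp add: ereal_integral_def e2ennreal_indicator e2ennreal_uminus_indicator
      zero_ennreal.rep_eq)

lemma ereal_integrable_indicator:
  assumes "A \<in> sets M" "emeasure M A < \<infinity>"
  shows "ereal_integrable M (indicator A)"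
  using assms
  by (simp add: ereal_integrable_def e2ennreal_indicator e2ennreal_uminus_indicator)

text \<open>The indicator is constantly 1 on a relative neighbourhood of \<open>y\<close>. Only
  points of \<open>A\<close> qualify, since it may jump at other points of \<open>S\<close>.\<close>

lemma continuous_indicator_openin:
  assumes "openin (top_of_set S) A" "y \<in> A"
  shows "continuous (at y within S) (indicator A :: 'a::t2_space \<Rightarrow> 'b::{topological_space, zero_neq_one})"
proof -
  obtain T where T: "open T" "A = S \<inter> T"
    using assms(1) by (auto simp: openin_open)
  have "\<forall>\<^sub>F z in at y within S. indicator A z = (1::'b)"
    using T assms(2) by (auto simp: eventually_at_topological intro!: exI[of _ T])
  then have "(indicator A \<longlongrightarrow> (1::'b)) (at y within S)"
    by (simp add: tendsto_eventually)
  then show ?thesis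
    using assms(2) by (simp add: continuous_within)
qed

theorem theorem2p6:
  fixes D A :: "'a::t2_space set"
    and \<omega> :: "'a \<Rightarrow> 'a set \<Rightarrow> ennreal"
  assumes "open D"
    and "frontier D \<noteq> {}"
    and "seq_accessible_boundary D"
    and "pre_harmonic_measure D \<omega>"
    and "regular_set D \<omega>"
    and "openin (top_of_set (frontier D)) A"
  shows "(SUP x\<in>D. ereal_integral (harmonic_measure D \<omega> x) (indicator A)) =
           Max ((indicator A :: 'a \<Rightarrow> ereal) ` frontier D) \<and>
         (\<forall>V\<in>components D.
           (\<exists>x0\<in>V. ereal_integral (harmonic_measure D \<omega> x0) (indicator A) =
                     (SUP x\<in>D. ereal_integral (harmonic_measure D \<omega> x) (indicator A))) \<longrightarrow>
           (\<lambda>x. ereal_integral (harmonic_measure D \<omega> x) (indicator A)) constant_on V)"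
proof -
  let ?I = "\<lambda>x. ereal_integral (harmonic_measure D \<omega> x) (indicator A)"
  have AF: "A \<subseteq> frontier D"
    using assms(6) openin_imp_subset by blast
  obtain T where "open T" "A = frontier D \<inter> T"
    using assms(6) by (auto simp: openin_open)
  then have AB: "A \<in> borel_sets_on (frontier D)"
    by (auto simp: sets_restrict_space)
  have AM: "A \<in> sets (harmonic_measure D \<omega> x)" if "x \<in> D" for x
    using AB borel_sets_on_subset_sets_harmonic_measure[OF assms(4) that] by blast
  have I: "?I x = enn2ereal (\<omega> x A)" if "x \<in> D" for x
    using ereal_integral_indicator[OF AM[OF that]]
      emeasure_harmonic_measure[OF assms(4) that AB] by simp
  have \<omega>: "borel_outer_measure_on (frontier D) (\<omega> x)" "\<omega> x A \<le> 1" if "x \<in> D" for x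
    using assms(4) that AF by (auto simp: pre_harmonic_measure_def)
  have I_le: "?I x \<le> 1" if "x \<in> D" for x
    using \<omega>(2)[OF that] I[OF that] by (simp add: less_eq_ennreal.rep_eq one_ennreal.rep_eq)
  show ?thesis
  proof (cases "A = {}")
    case True
    \<comment> \<open>The supremum of an empty family of \<open>ereal\<close> values would be
      -\<infinity> rather than 0.\<close>
    have "D \<noteq> {}" using assms(2) by auto
    moreover have I0: "?I x = 0" if "x \<in> D" for x
      using I[OF that] \<omega>(1)[OF that] True
      by (auto simp: borel_outer_measure_on_def zero_ennreal.rep_eq dest: outer_measure_on_empty)
    ultimately have "(SUP x\<in>D. ?I x) = 0"
      by (simp cong: SUP_cong)
    moreover have "(indicator A :: 'a \<Rightarrow> ereal) ` frontier D = {0}"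
      using assms(2) True by auto
    moreover have "?I constant_on V" if "V \<in> components D" for V
      using I0 in_components_subset[OF that] unfolding constant_on_def by blast
    ultimately show ?thesis by simp
  next
    case False
    then obtain y where y: "y \<in> A" by auto
    \<comment> \<open>Regularity only speaks about sequences, so \<open>y\<close> has to be the
      limit of one in \<open>D\<close>.\<close>
    then obtain s where s: "\<And>n. s n \<in> D" "s \<longlonglongrightarrow> y"
      using assms(3) AF unfolding seq_accessible_boundary_def by blast
    have "ereal_integrable (harmonic_measure D \<omega> x) (indicator A)" if "x \<in> D" for x
      using ereal_integrable_indicator[OF AM[OF that]] \<omega>(2)[OF that]
        emeasure_harmonic_measure[OF assms(4) that AB] by (simp add: order_le_less_trans)
    then have "indicator A \<in> harmonic_L D \<omega>"
      by (simp add: harmonic_L_def)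
    then have "(\<lambda>n. ?I (s n)) \<longlonglongrightarrow> indicator A y"
      using assms(5) AF y s continuous_indicator_openin[OF assms(6) y]
      unfolding regular_set_def regular_point_def by blast
    \<comment> \<open>Every term of the sequence is below the supremum, hence so is its limit, which
      is 1 because \<open>y\<close> lies in \<open>A\<close>.\<close>
    then have "indicator A y \<le> (SUP x\<in>D. ?I x)"
      by (rule LIMSEQ_le_const2) (use s in \<open>auto intro!: SUP_upper\<close>)
    then have sup: "(SUP x\<in>D. ?I x) = 1"
      using y I_le by (intro antisym SUP_least) auto
    have "Max ((indicator A :: 'a \<Rightarrow> ereal) ` frontier D) = 1"
    proof (rule Max_eqI)
      \<comment> \<open>\<open>Max\<close> is meaningful only on finite sets; the image has at most
        two values.\<close>
      have "(indicator A :: 'a \<Rightarrow> ereal) ` frontier D \<subseteq> {0, 1}"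
        by (auto simp: indicator_def)
      then show "finite ((indicator A :: 'a \<Rightarrow> ereal) ` frontier D)"
        by (rule finite_subset) simp
      show "1 \<in> (indicator A :: 'a \<Rightarrow> ereal) ` frontier D"
        using y AF by (auto simp: image_iff intro!: bexI[of _ y])
    qed (auto simp: indicator_def)
    \<comment> \<open>Constancy is obtained on one component at a time, because
      \<open>pre_harmonic_measure\<close> compares \<open>\<omega> x\<close> and
      \<open>\<omega> y\<close> only for points of the same component.\<close>
    moreover have const: "?I constant_on V"
      if V: "V \<in> components D" and x0: "x0 \<in> V" "?I x0 = 1" for V x0
    proof -
      have VD: "V \<subseteq> D" using in_components_subset[OF V] .
      \<comment> \<open>The total mass of \<open>frontier D\<close> is squeezed between 1, the mass
        of \<open>frontier V \<inter> frontier D\<close>, and the upper bound 1. Testing the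
        measurable set \<open>A\<close> against all of \<open>frontier D\<close> then splits this
        mass.\<close>
      have add: "\<omega> x A + \<omega> x (frontier D - A) = 1" if "x \<in> V" for x
      proof -
        have om: "outer_measure_on (frontier D) (\<omega> x)"
          using \<omega>(1) that VD by (auto simp: borel_outer_measure_on_def)
        have "\<omega> x (frontier V \<inter> frontier D) = 1"
          using assms(4) V that by (auto simp: pre_harmonic_measure_def)
        moreover have "\<omega> x (frontier V \<inter> frontier D) \<le> \<omega> x (frontier D)"
          using outer_measure_on_mono[OF om] by auto
        moreover have "\<omega> x (frontier D) \<le> 1"
          using assms(4) that VD by (auto simp: pre_harmonic_measure_def)
        ultimately have "\<omega> x (frontier D) = 1" by auto
        moreover have "A \<in> lambda_system (frontier D) (Pow (frontier D)) (\<omega> x)"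
          using \<omega>(1) that VD AB by (auto simp: borel_outer_measure_on_def)
        then have "\<omega> x (A \<inter> frontier D) + \<omega> x ((frontier D - A) \<inter> frontier D) = \<omega> x (frontier D)"
          by (auto simp: lambda_system_def)
        moreover have "A \<inter> frontier D = A" "(frontier D - A) \<inter> frontier D = frontier D - A"
          using AF by auto
        ultimately show ?thesis by simp
      qed
      have one: "\<omega> x A = 1 \<longleftrightarrow> ?I x = 1" if "x \<in> V" for x
        using I that VD by (metis enn2ereal_inject one_ennreal.rep_eq subsetD)
      have "\<omega> x0 A = 1" using one x0 by simp
      \<comment> \<open>Cancelling \<open>\<omega> x0 A\<close> in \<open>ennreal\<close> is
        legitimate because it equals 1, which is finite.\<close>
      with add[OF x0(1)] have "\<omega> x0 (frontier D - A) = 0"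
        by (metis add.right_neutral ennreal_add_left_cancel ennreal_one_neq_top infinity_ennreal_def)
      \<comment> \<open>Absolute continuity carries the null complement of \<open>A\<close> from
        \<open>x0\<close> to every \<open>x\<close> in \<open>V\<close>; then \<open>add\<close>
        leaves mass 1 for \<open>A\<close>.\<close>
      moreover have "outer_abs_continuous_on (frontier D) (\<omega> x) (\<omega> x0)" if "x \<in> V" for x
        using assms(4) V that x0(1) by (auto simp: pre_harmonic_measure_def)
      ultimately have "\<omega> x (frontier D - A) = 0" if "x \<in> V" for x
        using that by (auto simp: outer_abs_continuous_on_def)
      then have "?I x = 1" if "x \<in> V" for x
        using add[OF that] one[OF that] that by simp
      then show ?thesis unfolding constant_on_def by blast
    qed
    ultimately show ?thesis
      unfolding sup by (intro conjI ballI impI) (simp, elim bexE, rule const)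
  qed
qed

end
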